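(* Exactly $16$ of the $64$ words $P=(h_0,h_1,u_0,u_1,l_0,l_1)\in\{M,V\}^6$ satisfy $\delta_0=\delta_1=-1$, where, with $M=+1$ and $V=-1$, $\delta_i=h_0h_1u_il_i$ for $i=0,1$. The other $48$ words have empty state set, $F(P,k)=\varnothing$, for every $k\ge2$.
   Context: Map and assignment. Let $k\ge2$, $n=2k$. The upper faces are $A_1,\dots,A_n$, the lower faces $B_1,\dots,B_n$. The creases are $H_c=(A_c,B_c)$ ($1\le c\le n$), $U_i=(A_i,A_{i+1})$ and $L_i=(B_i,B_{i+1})$ ($1\le i\le n-1$); the two faces of a crease are its wings. A word $P=(h_0,h_1,u_0,u_1,l_0,l_1)\in\{M,V\}^6$ assigns to $H_c$ the label $h_{(c-1)\bmod 2}$ and to $U_i,L_i$ the labels $u_{(i-1)\bmod2},l_{(i-1)\bmod2}$. The assignment is locally flat-foldable if for every $1\le c\le n-1$ an odd number of the four creases $H_c,H_{c+1},U_c,L_c$ (meeting at an interior vertex) are labelled $M$. States. $x\prec y$ means $x$ lies above (comes before) $y$ in a total order. A strict total order of all $4k$ labelled faces is order-valid for $P$ if: (i) Precedence: with $A_c$ in row $r=0$ and $B_c$ in row $r=1$, the face in row $r$, column $c$ is light-up iff $r+c-1$ is even and dark-up otherwise; across each $M$ crease the light-up wing precedes the dark-up wing, across each $V$ crease the dark-up wing precedes the light-up wing. (ii) Noncrossing: every $H_c$ has target class $S$; $U_i$ and $L_i$ have class $E$ for $i$ odd and $W$ for $i$ even; for any two distinct creases of the same target class with disjoint wing sets, with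 wing positions $a_0<a_1$ and $b_0<b_1$ in the order, neither $a_0<b_0<a_1<b_1$ nor $b_0<a_0<b_1<a_1$. $F(P,k)$ is the set of all order-valid strict total orders if $P$ is locally flat-foldable, and $F(P,k)=\varnothing$ otherwise. *)

theory Defs
  imports Main
begin

datatype label = Mountain | Valley

text \<open>Faces and creases carry their column index, counted from 1.\<close>

datatype face = A nat | B nat

datatype crease = H nat | U nat | L nat

datatype target = South | East | West

definition faces :: "nat \<Rightarrow> face set" where
  "faces k = A ` {1..2 * k} \<union> B ` {1..2 * k}"

definition creases :: "nat \<Rightarrow> crease set" where
  "creases k = H ` {1..2 * k} \<union> U ` {1..2 * k - 1} \<union> L ` {1..2 * k - 1}"

fun wings :: "crease \<Rightarrow> face set" where
  "wings (H c) = {A c, B c}"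
| "wings (U i) = {A i, A (i + 1)}"
| "wings (L i) = {B i, B (i + 1)}"

fun target_class :: "crease \<Rightarrow> target" where
  "target_class (H c) = South"
| "target_class (U i) = (if odd i then East else West)"
| "target_class (L i) = (if odd i then East else West)"

text \<open>A word lists the labels \<open>(h\<^sub>0, h\<^sub>1, u\<^sub>0, u\<^sub>1, l\<^sub>0, l\<^sub>1)\<close>; the selectors below
  are only meant for the indices 0 and 1.\<close>

type_synonym word = "label \<times> label \<times> label \<times> label \<times> label \<times> label"

fun h_label :: "word \<Rightarrow> nat \<Rightarrow> label" where
  "h_label (h0, h1, u0, u1, l0, l1) j = (if j = 0 then h0 else h1)"

fun u_label :: "word \<Rightarrow> nat \<Rightarrow> label" where
  "u_label (h0, h1, u0, u1, l0, l1) j = (if j = 0 then u0 else u1)"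

fun l_label :: "word \<Rightarrow> nat \<Rightarrow> label" where
  "l_label (h0, h1, u0, u1, l0, l1) j = (if j = 0 then l0 else l1)"

fun assignment :: "word \<Rightarrow> crease \<Rightarrow> label" where
  "assignment P (H c) = h_label P ((c - 1) mod 2)"
| "assignment P (U i) = u_label P ((i - 1) mod 2)"
| "assignment P (L i) = l_label P ((i - 1) mod 2)"

fun label_sign :: "label \<Rightarrow> int" where
  "label_sign Mountain = 1"
| "label_sign Valley = - 1"

definition delta :: "word \<Rightarrow> nat \<Rightarrow> int" where
  "delta P i = label_sign (h_label P 0) * label_sign (h_label P 1)
     * label_sign (u_label P i) * label_sign (l_label P i)"

definition locally_flat_foldable :: "word \<Rightarrow> nat \<Rightarrow> bool" where
  "locally_flat_foldable P k \<longleftrightarrow>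
     (\<forall>c\<in>{1..2 * k - 1}. odd (card {x \<in> {H c, H (c + 1), U c, L c}. assignment P x = Mountain}))"

fun light_up :: "face \<Rightarrow> bool" where
  "light_up (A c) \<longleftrightarrow> even (0 + c - 1)"
| "light_up (B c) \<longleftrightarrow> even (1 + c - 1)"

text \<open>An order is the set \<open>R\<close> of pairs \<open>(x, y)\<close> such that \<open>x\<close> lies above \<open>y\<close>.\<close>

definition precedence :: "word \<Rightarrow> nat \<Rightarrow> (face \<times> face) set \<Rightarrow> bool" where
  "precedence P k R \<longleftrightarrow>
     (\<forall>x\<in>creases k. \<forall>a\<in>wings x. \<forall>b\<in>wings x. light_up a \<and> \<not> light_up b \<longrightarrow>
        (case assignment P x of Mountain \<Rightarrow> (a, b) \<in> R | Valley \<Rightarrow> (b, a) \<in> R))"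

definition noncrossing :: "nat \<Rightarrow> (face \<times> face) set \<Rightarrow> bool" where
  "noncrossing k R \<longleftrightarrow>
     (\<forall>x\<in>creases k. \<forall>y\<in>creases k. \<forall>a0 a1 b0 b1.
        x \<noteq> y \<and> target_class x = target_class y \<and> wings x \<inter> wings y = {} \<and>
        wings x = {a0, a1} \<and> (a0, a1) \<in> R \<and> wings y = {b0, b1} \<and> (b0, b1) \<in> R \<longrightarrow>
        \<not> ((a0, b0) \<in> R \<and> (b0, a1) \<in> R \<and> (a1, b1) \<in> R) \<and>
        \<not> ((b0, a0) \<in> R \<and> (a0, b1) \<in> R \<and> (b1, a1) \<in> R))"

text \<open>\<open>strict_linear_order_on\<close> does not confine the relation to the given set; the inclusion in
  \<open>faces k \<times> faces k\<close> makes the order and its relation correspond one to one.\<close>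

definition order_valid :: "word \<Rightarrow> nat \<Rightarrow> (face \<times> face) set \<Rightarrow> bool" where
  "order_valid P k R \<longleftrightarrow>
     R \<subseteq> faces k \<times> faces k \<and> strict_linear_order_on (faces k) R \<and>
     precedence P k R \<and> noncrossing k R"

definition F :: "word \<Rightarrow> nat \<Rightarrow> (face \<times> face) set set" where
  "F P k = (if locally_flat_foldable P k then {R. order_valid P k R} else {})"

end

theory Submission
  imports Defs
begin

text \<open>The product of the four signs at an interior vertex is \<open>- 1\<close> exactly when an odd number
  of its creases are mountains. At column \<open>c\<close> this product is \<open>delta P ((c - 1) mod 2)\<close>, and for
  \<open>k \<ge> 2\<close> the vertices in columns 1 and 2 both occur.\<close>

lemma UNIV_label: "(UNIV :: label set) = {Mountain, Valley}"
  using label.exhaust by auto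

text \<open>Finiteness passes on to \<open>word\<close> through the product instances; counting a
  complement by subtraction relies on it.\<close>

instance label :: finite
  by standard (simp add: UNIV_label)

lemma card_UNIV_label: "card (UNIV :: label set) = 2"
  by (simp add: UNIV_label)

lemma card_UNIV_word: "card (UNIV :: word set) = 64"
  by (simp add: card_UNIV_label flip: UNIV_Times_UNIV)

text \<open>Both conditions on \<open>delta\<close> can be solved for the last two labels, so the first four
  labels are free.\<close>

lemma card_delta_minus_one: "card {P. delta P 0 = -1 \<and> delta P 1 = -1} = 16"
proof -
  \<comment> \<open>The fourth label must have the sign opposite to the product of the other
    three.\<close>
  define neg where "neg h h' u = (if label_sign h * label_sign h' * label_sign u = 1
    then Valley else Mountain)" for h h' u
  define f where "f = (\<lambda>(h, h', u, u'). (h, h', u, u', neg h h' u, neg h h' u'))"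
  have solve: "label_sign h * label_sign h' * label_sign u * label_sign l = -1 \<longleftrightarrow> l = neg h h' u"
    for h h' u l
    by (cases h; cases h'; cases u; cases l) (simp_all add: neg_def)
  have "{P. delta P 0 = -1 \<and> delta P 1 = -1} = range f"
    by (auto simp: delta_def solve f_def image_iff)
  moreover have "inj f"
    by (auto simp: inj_def f_def)
  ultimately show ?thesis
    by (simp add: card_image card_UNIV_label flip: UNIV_Times_UNIV)
qed

text \<open>After negation a mountain contributes the factor -1 and a valley the factor 1, so the
  product records the parity of the number of mountains.\<close>

lemma prod_uminus_label_sign:
  assumes "finite S"
  shows "(\<Prod>x\<in>S. - label_sign (f x)) = (-1) ^ card {x \<in> S. f x = Mountain}"
  using assms
proof (induction S rule: finite_induct)
  case (insert a S)
  have "{x \<in> insert a S. f x = Mountain} =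
      (if f a = Mountain then insert a {x \<in> S. f x = Mountain} else {x \<in> S. f x = Mountain})"
    by auto
  then show ?case
    using insert by (cases "f a") simp_all
qed simp

lemma odd_mountains_iff_delta:
  assumes "c \<ge> 1"
  shows "odd (card {x \<in> {H c, H (c + 1), U c, L c}. assignment P x = Mountain})
    \<longleftrightarrow> delta P ((c - 1) mod 2) = -1"
proof -
  \<comment> \<open>Consecutive columns have opposite parity, so \<open>H c\<close> and
    \<open>H (c + 1)\<close> carry both horizontal labels in some order. At \<open>c = 0\<close>
    truncated subtraction would make the two indices coincide.\<close>
  have "h_label P ((c - 1) mod 2) = h_label P 0 \<and> h_label P (c mod 2) = h_label P 1 \<or>
      h_label P ((c - 1) mod 2) = h_label P 1 \<and> h_label P (c mod 2) = h_label P 0"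
    using assms by (cases c; cases P) (auto simp: mod_Suc)
  \<comment> \<open>The four creases are distinct, and the four minus signs cancel.\<close>
  then have "(\<Prod>x\<in>{H c, H (c + 1), U c, L c}. - label_sign (assignment P x)) =
      delta P ((c - 1) mod 2)"
    by (auto simp: delta_def)
  then show ?thesis
    using prod_uminus_label_sign[of "{H c, H (c + 1), U c, L c}" "assignment P"]
    by (simp add: minus_one_power_iff)
qed

lemma locally_flat_foldable_imp_delta:
  assumes "locally_flat_foldable P k" "k \<ge> 2"
  shows "delta P 0 = -1 \<and> delta P 1 = -1"
proof -
  have "delta P ((c - 1) mod 2) = -1" if "c \<in> {1..2 * k - 1}" for c
    using assms(1) that odd_mountains_iff_delta[of c P] unfolding locally_flat_foldable_def by auto
  from this[of 1] this[of 2] assms(2) show ?thesis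
    by simp
qed

theorem corollary4p2:
  "card (UNIV :: word set) = 64
   \<and> card {P. delta P 0 = -1 \<and> delta P 1 = -1} = 16
   \<and> card {P. \<not> (delta P 0 = -1 \<and> delta P 1 = -1)} = 48
   \<and> (\<forall>P. \<not> (delta P 0 = -1 \<and> delta P 1 = -1) \<longrightarrow> (\<forall>k\<ge>2. F P k = {}))"
proof (intro conjI allI impI)
  have "card {P. \<not> (delta P 0 = -1 \<and> delta P 1 = -1)} =
      card (UNIV :: word set) - card {P. delta P 0 = -1 \<and> delta P 1 = -1}"
    unfolding Collect_neg_eq Compl_eq_Diff_UNIV by (rule card_Diff_subset) simp_all
  then show "card {P. \<not> (delta P 0 = -1 \<and> delta P 1 = -1)} = 48"
    unfolding card_UNIV_word card_delta_minus_one by simp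
next
  fix P k
  assume "\<not> (delta P 0 = -1 \<and> delta P 1 = -1)" "2 \<le> (k::nat)"
  \<comment> \<open>Local flat-foldability fails, which selects the empty branch of
    \<open>F_def\<close>.\<close>
  then show "F P k = {}"
    using locally_flat_foldable_imp_delta[of P k] by (auto simp: F_def)
qed (rule card_UNIV_word card_delta_minus_one)+

end
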